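(* Let $\{\boldsymbol{x}_i\}_{i\in\Phi_1}$ be the points of a homogeneous Poisson point process $\Phi_1$ on $\mathbb{R}^2$ with intensity $\lambda_1$, and let $S(\cdot)$ and $P(\cdot)$ be two real-valued functions on the state space $\mathbb{R}^2$ of $\Phi_1$. Then $$\mathbb{E}\left\{ \prod_{k\in \Phi_1} P(\boldsymbol{x}_k) \sum_{k\in \Phi_1} S(\boldsymbol{x}_k) \right\} = \lambda_1 \iint_{\mathbb{R}^2} S(\boldsymbol{s})P(\boldsymbol{s})\, d\boldsymbol{s} \; \exp\left( \lambda_1 \iint_{\mathbb{R}^2} \big( P(\boldsymbol{s}) - 1\big)\, d\boldsymbol{s} \right).$$
   Context: The notation $k\in\Phi_1$ means that $k$ ranges over the index set of the points $\boldsymbol{x}_k$ of the point process $\Phi_1$; the product and the sum are over all points of the process.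
   Formalization: The functions S and P are assumed Borel measurable, with S·P and P−1 Lebesgue integrable on the plane, so that both integrals on the right exist and are finite; for arbitrary real-valued functions the formula is not defined. *)

theory Defs
  imports "HOL-Probability.Probability"
begin

text \<open>
  A point process is represented by the random set \<open>\<Phi> \<omega>\<close> of its points, which is the usual
  convention for simple processes: a homogeneous Poisson process has almost surely no multiple
  points. Counts are only taken in bounded sets, where \<^const>\<open>card\<close> is meaningful
  by local finiteness. The case \<open>lam = 0\<close> (almost surely no points) is admitted.
\<close>

locale homogeneous_poisson_process = prob_space M
  for M :: "'w measure" +
  fixes lam :: real
    and \<Phi> :: "'w \<Rightarrow> 'a::euclidean_space set"
  assumes intensity_nonneg: "0 \<le> lam"
    and locally_finite: "\<And>\<omega> B. \<omega> \<in> space M \<Longrightarrow> bounded B \<Longrightarrow> finite (\<Phi> \<omega> \<inter> B)"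
    and count_measurable: "\<And>B. B \<in> sets borel \<Longrightarrow> bounded B \<Longrightarrow>
      (\<lambda>\<omega>. card (\<Phi> \<omega> \<inter> B)) \<in> measurable M (count_space UNIV)"
    and count_poisson: "\<And>B n. B \<in> sets borel \<Longrightarrow> bounded B \<Longrightarrow>
      prob {\<omega> \<in> space M. card (\<Phi> \<omega> \<inter> B) = n} =
        exp (- (lam * measure lborel B)) * (lam * measure lborel B) ^ n / fact n"
    and count_indep: "\<And>\<B>. finite \<B> \<Longrightarrow> disjoint \<B> \<Longrightarrow>
      (\<And>B. B \<in> \<B> \<Longrightarrow> B \<in> sets borel \<and> bounded B) \<Longrightarrow>
      indep_vars (\<lambda>_. count_space UNIV) (\<lambda>B \<omega>. card (\<Phi> \<omega> \<inter> B)) \<B>"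

text \<open>
  Unordered products over an arbitrary index set, the multiplicative counterpart of
  \<^const>\<open>has_sum\<close> and \<^const>\<open>infsum\<close>. As for \<^const>\<open>has_prod\<close>, a product whose partial products
  tend to 0 without absolute convergence (such as a constant factor 1/2) is not assigned
  its limit; \<open>infprod\<close> then has the dummy value 1.
\<close>

definition has_infprod :: "('a \<Rightarrow> real) \<Rightarrow> real \<Rightarrow> 'a set \<Rightarrow> bool" where
  "has_infprod f p A \<longleftrightarrow> (prod f \<longlongrightarrow> p) (finite_subsets_at_top A)"

definition infprod :: "('a \<Rightarrow> real) \<Rightarrow> 'a set \<Rightarrow> real" where
  "infprod f A =
    (if (\<lambda>x. \<bar>f x - 1\<bar>) summable_on A then Lim (finite_subsets_at_top A) (prod f) else 1)"

lemma has_infprod_finite: "finite A \<Longrightarrow> has_infprod f (prod f A) A"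
  by (simp add: has_infprod_def finite_subsets_at_top_finite filterlim_principal
      tendsto_principal_singleton)

lemma infprod_finite: "finite A \<Longrightarrow> infprod f A = prod f A"
  using has_infprod_finite[of A f]
  by (auto simp: infprod_def has_infprod_def intro!: tendsto_Lim)

end

theory Submission
  imports Defs
begin

text \<open>
  Suppose that \<open>P\<close> and \<open>S\<close> take finitely many values on a bounded window. Then the product
  and the sum over the points in the window depend only on the numbers of points in finitely many
  disjoint cells. These are independent Poisson variables, and for such an \<open>N\<close> with parameter
  \<open>z\<close> the series for \<open>exp\<close> gives \<open>E (p ^ N) = exp (z * (p - 1))\<close> and
  \<open>E (N * p ^ N) = z * p * exp (z * (p - 1))\<close>. Multiplying over the cells and summing over the
  cell that carries the factor \<open>N\<close> yields the formula (\<open>has_bochner_integral_simple\<close>).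

  What remains is two passages to the limit: from step functions to measurable functions on a fixed
  window (\<open>has_bochner_integral_bounded\<close>), and from balls to the whole space
  (\<open>has_bochner_integral_infprod_infsum\<close>). The difficulty is to find dominating functions, as
  only \<open>S * P\<close> and \<open>P - 1\<close> are integrable and \<open>P\<close> may be unbounded, negative or zero. On a
  window, \<open>\<bar>P\<bar>\<close> and \<open>\<bar>S\<bar>\<close> themselves serve. For growing windows they do not, because
  the product of \<open>\<bar>P\<bar>\<close> is not monotone in the window: factors below \<open>1\<close> make it smaller. There one uses that
  \<open>(\<Prod>x. P x) * (\<Sum>x. S x)\<close> is the sum over \<open>x\<close> of \<open>S x * P x\<close> times the product of \<open>P\<close> over
  the other points. Enlarging only those other factors to \<open>Q = max 1 \<bar>P\<bar>\<close> gives
  a bound that increases with the window and whose expectation, by the same formula, involves just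
  the integrals of \<open>\<bar>S * P\<bar>\<close> and \<open>Q - 1\<close>.

  Almost sure convergence of the sum and the product comes from the case \<open>P = 1\<close>, Campbell's
  formula (\<open>AE_summable_on\<close>), applied to \<open>P - 1\<close> and \<open>S * P\<close>, together with
  \<open>summable_on_cancel_factor\<close> and \<open>has_infprod_infprod\<close>.
\<close>

section \<open>Sums and products over locally finite sets\<close>

lemma summable_on_finite_exceedance:
  fixes g :: "'a \<Rightarrow> real"
  assumes "g summable_on A" "\<And>x. x \<in> A \<Longrightarrow> 0 \<le> g x" "0 < e"
  shows "finite {x \<in> A. e \<le> g x}"
proof (rule ccontr)
  assume inf: "infinite {x \<in> A. e \<le> g x}"
  obtain n :: nat where n: "infsum g A / e < real n"
    using reals_Archimedean2 by blast
  obtain T where T: "T \<subseteq> {x \<in> A. e \<le> g x}" "finite T" "card T = n"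
    using inf infinite_arbitrarily_large by blast
  have "real n * e = (\<Sum>x\<in>T. e)"
    using T by simp
  also have "\<dots> \<le> sum g T"
    using T by (intro sum_mono) auto
  also have "\<dots> \<le> infsum g A"
    using T assms by (intro finite_sum_le_infsum) auto
  finally show False
    using n \<open>0 < e\<close> by (simp add: field_simps)
qed

text \<open>
Only finitely many factors differ from \<open>1\<close> by \<open>1/2\<close> or more. All other factors are
positive with \<open>\<bar>ln (f x)\<bar> \<le> 2 * \<bar>f x - 1\<bar>\<close>, so their product is the exponential of an
absolutely convergent sum of logarithms.
\<close>

lemma has_infprod_infprod:
  assumes sm: "(\<lambda>x. \<bar>f x - 1\<bar>) summable_on A"
  shows "has_infprod f (infprod f A) A"
proof -
  define F where "F = {x \<in> A. 1/2 \<le> \<bar>f x - 1\<bar>}"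
  define h where "h x = (if x \<in> F then 0 else ln (f x))" for x
  have F: "finite F" "F \<subseteq> A"
    using summable_on_finite_exceedance[OF sm, of "1/2"] by (auto simp: F_def)
  have near: "\<bar>f x - 1\<bar> < 1/2" if "x \<in> A" "x \<notin> F" for x
    using that by (auto simp: F_def)
  have h_le: "norm (h x) \<le> 2 * \<bar>f x - 1\<bar>" if "x \<in> A" for x
  proof (cases "x \<in> F")
    case False
    have "\<bar>ln (f x) - (f x - 1)\<bar> \<le> 2 * (f x - 1)\<^sup>2"
      using abs_ln_one_plus_x_minus_x_bound[of "f x - 1"] near[OF that False] by simp
    also have "2 * (f x - 1)\<^sup>2 \<le> \<bar>f x - 1\<bar>"
      using near[OF that False] mult_right_mono[of "2 * \<bar>f x - 1\<bar>" 1 "\<bar>f x - 1\<bar>"]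
      by (simp add: power2_eq_square flip: abs_mult)
    finally have "\<bar>ln (f x) - (f x - 1)\<bar> \<le> \<bar>f x - 1\<bar>" .
    then have "\<bar>ln (f x)\<bar> \<le> 2 * \<bar>f x - 1\<bar>"
      using abs_triangle_ineq[of "ln (f x) - (f x - 1)" "f x - 1"] by simp
    then show ?thesis
      using False by (simp add: h_def)
  qed (simp add: h_def)
  have "(\<lambda>x. norm (h x)) summable_on A"
    using h_le by (intro Infinite_Sum.abs_summable_on_comparison_test'[OF summable_on_cmult_right[OF sm, of 2]]) auto
  then have "h summable_on A"
    using abs_summable_summable by blast
  then have lim: "((\<lambda>X. prod f F * exp (sum h X)) \<longlongrightarrow> prod f F * exp (infsum h A))
      (finite_subsets_at_top A)"
    by (intro tendsto_intros infsum_tendsto)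
  have "\<forall>\<^sub>F X in finite_subsets_at_top A. prod f F * exp (sum h X) = prod f X"
    unfolding eventually_finite_subsets_at_top
  proof (intro exI[of _ F] conjI allI impI F)
    fix X assume X: "finite X \<and> F \<subseteq> X \<and> X \<subseteq> A"
    have "exp (sum h X) = (\<Prod>x\<in>X. exp (h x))"
      using X by (simp add: exp_sum)
    also have "\<dots> = (\<Prod>x\<in>X - F. exp (h x))"
      using X by (intro prod.mono_neutral_right) (auto simp: h_def)
    also have "\<dots> = prod f (X - F)"
    proof (intro prod.cong refl)
      fix x assume x: "x \<in> X - F"
      then have "\<bar>f x - 1\<bar> < 1/2"
        using near[of x] X by blast
      then have "0 < f x"
        by linarith
      then show "exp (h x) = f x"
        using x by (simp add: h_def)
    qed
    finally show "prod f F * exp (sum h X) = prod f X"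
      using X by (simp add: prod.subset_diff[of F X f] mult.commute)
  qed
  with lim have "(prod f \<longlongrightarrow> prod f F * exp (infsum h A)) (finite_subsets_at_top A)"
    by (rule Lim_transform_eventually)
  moreover from this have "infprod f A = prod f F * exp (infsum h A)"
    using sm by (auto simp: infprod_def intro!: tendsto_Lim)
  ultimately show ?thesis
    by (simp add: has_infprod_def)
qed

text \<open>
Except at finitely many \<open>x\<close>, \<open>\<bar>P x\<bar> \<ge> 1/2\<close> and hence \<open>\<bar>S x\<bar> \<le> 2 * \<bar>S x * P x\<bar>\<close>.
This makes the sum of \<open>S\<close> over the points converge although \<open>S\<close> itself may fail to be
integrable where \<open>P\<close> vanishes.
\<close>

lemma summable_on_cancel_factor:
  fixes P S :: "'a \<Rightarrow> real"
  assumes P: "(\<lambda>x. \<bar>P x - 1\<bar>) summable_on A" and SP: "(\<lambda>x. \<bar>S x * P x\<bar>) summable_on A"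
  shows "S summable_on A"
proof -
  define F where "F = {x \<in> A. 1/2 \<le> \<bar>P x - 1\<bar>}"
  have F: "finite F"
    using summable_on_finite_exceedance[OF P, of "1/2"] by (auto simp: F_def)
  have "(\<lambda>x. norm (S x)) summable_on (A - F)"
  proof (rule Infinite_Sum.abs_summable_on_comparison_test')
    show "(\<lambda>x. 2 * \<bar>S x * P x\<bar>) summable_on (A - F)"
      by (intro summable_on_cmult_right summable_on_subset[OF SP]) auto
    fix x assume "x \<in> A - F"
    then have "\<bar>P x - 1\<bar> < 1/2"
      by (auto simp: F_def not_le)
    then have "1/2 \<le> \<bar>P x\<bar>"
      by linarith
    then show "norm (S x) \<le> 2 * \<bar>S x * P x\<bar>"
      using mult_left_mono[of "1/2" "\<bar>P x\<bar>" "\<bar>S x\<bar>"] by (simp add: abs_mult)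
  qed
  then have "S summable_on (A - F)"
    by (rule abs_summable_summable)
  then have "S summable_on ((A - F) \<union> F)"
    using F by (rule summable_on_union[OF _ summable_on_finite])
  then show ?thesis
    by (rule summable_on_subset) auto
qed

text \<open>
Unordered sums and products over a locally finite set are thereby limits of sequences, as the
measurability and convergence theorems for integrals require.
\<close>

lemma filterlim_cball_finite_subsets:
  fixes A :: "'a::real_normed_vector set"
  assumes "\<And>k. finite (A \<inter> cball 0 (real k))"
  shows "filterlim (\<lambda>k. A \<inter> cball 0 (real k)) (finite_subsets_at_top A) sequentially"
  unfolding filterlim_finite_subsets_at_top
proof (intro allI impI)
  fix X assume X: "finite X \<and> X \<subseteq> A"
  then obtain r where r: "\<And>x. x \<in> X \<Longrightarrow> norm x \<le> r"
    using finite_imp_bounded[of X] by (auto simp: bounded_iff)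
  show "\<forall>\<^sub>F k in sequentially. finite (A \<inter> cball 0 (real k)) \<and> X \<subseteq> A \<inter> cball 0 (real k) \<and>
      A \<inter> cball 0 (real k) \<subseteq> A"
    using eventually_ge_at_top[of "nat \<lceil>r\<rceil>"]
  proof eventually_elim
    case (elim k)
    then have "r \<le> real k" by linarith
    then show ?case
      using X r assms by force
  qed
qed

text \<open>
Expresses summability by countably many finite sums, which makes it an event when \<open>A\<close> is random.
\<close>

lemma summable_on_iff_SUP_cball:
  fixes A :: "'a::real_normed_vector set" and f :: "'a \<Rightarrow> real"
  assumes fin: "\<And>k. finite (A \<inter> cball 0 (real k))"
  shows "f summable_on A \<longleftrightarrow> (SUP k. ennreal (\<Sum>x\<in>A \<inter> cball 0 (real k). \<bar>f x\<bar>)) \<noteq> \<infinity>"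
proof
  assume "f summable_on A"
  then have sm: "(\<lambda>x. \<bar>f x\<bar>) summable_on A"
    using summable_on_iff_abs_summable_on_real[of f A] by simp
  have "(SUP k. ennreal (\<Sum>x\<in>A \<inter> cball 0 (real k). \<bar>f x\<bar>)) \<le> ennreal (infsum (\<lambda>x. \<bar>f x\<bar>) A)"
    using fin by (intro SUP_least ennreal_leI finite_sum_le_infsum sm) auto
  then show "(SUP k. ennreal (\<Sum>x\<in>A \<inter> cball 0 (real k). \<bar>f x\<bar>)) \<noteq> \<infinity>"
    using neq_top_trans[OF ennreal_neq_top] unfolding infinity_ennreal_def by blast
next
  assume "(SUP k. ennreal (\<Sum>x\<in>A \<inter> cball 0 (real k). \<bar>f x\<bar>)) \<noteq> \<infinity>"
  then obtain c where c: "0 \<le> c" "(SUP k. ennreal (\<Sum>x\<in>A \<inter> cball 0 (real k). \<bar>f x\<bar>)) = ennreal c"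
    by (metis ennreal_cases infinity_ennreal_def)
  have le: "(\<Sum>x\<in>A \<inter> cball 0 (real k). \<bar>f x\<bar>) \<le> c" for k
    using SUP_upper[of k UNIV "\<lambda>k. ennreal (\<Sum>x\<in>A \<inter> cball 0 (real k). \<bar>f x\<bar>)"] c by simp
  have "(\<lambda>x. \<bar>f x\<bar>) summable_on A"
  proof (rule nonneg_bdd_above_summable_on)
    show "bdd_above (sum (\<lambda>x. \<bar>f x\<bar>) ` {F. F \<subseteq> A \<and> finite F})"
    proof (rule bdd_aboveI2)
      fix F assume F: "F \<in> {F. F \<subseteq> A \<and> finite F}"
      have "\<forall>\<^sub>F k in sequentially. F \<subseteq> A \<inter> cball 0 (real k)"
        using filterlim_cball_finite_subsets[OF fin] F
        unfolding filterlim_finite_subsets_at_top by (auto elim!: eventually_mono)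
      then obtain k where "F \<subseteq> A \<inter> cball 0 (real k)"
        by (auto simp: eventually_sequentially)
      then have "(\<Sum>x\<in>F. \<bar>f x\<bar>) \<le> (\<Sum>x\<in>A \<inter> cball 0 (real k). \<bar>f x\<bar>)"
        using fin by (intro sum_mono2) auto
      with le[of k] show "(\<Sum>x\<in>F. \<bar>f x\<bar>) \<le> c" by linarith
    qed
  qed auto
  then show "f summable_on A"
    using summable_on_iff_abs_summable_on_real[of f A] by simp
qed

text \<open>
Approximate \<open>\<bar>f\<bar>\<close> from below and restore the sign. The bound has constant \<open>1\<close> because it
is to be multiplied over all points of a configuration, where any larger constant would become
exponential in their number.
\<close>

lemma simple_function_approx_abs_le:
  fixes f :: "'a \<Rightarrow> real"
  assumes [measurable]: "f \<in> borel_measurable M"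
  obtains F where "\<And>i. simple_function M (F i)" "\<And>x. (\<lambda>i. F i x) \<longlonglongrightarrow> f x"
    "\<And>i x. \<bar>F i x\<bar> \<le> \<bar>f x\<bar>"
proof -
  obtain g where g: "incseq g" "\<And>i. simple_function M (g i)" "\<And>x. bdd_above (range (\<lambda>i. g i x))"
    "\<And>i x. 0 \<le> g i x" "(\<lambda>x. \<bar>f x\<bar>) = (SUP i. g i)"
    using borel_measurable_implies_simple_function_sequence_real[of "\<lambda>x. \<bar>f x\<bar>" M] by auto
  have SUP: "\<bar>f x\<bar> = (SUP i. g i x)" for x
    using fun_cong[OF g(5), of x] by (simp add: image_comp)
  have lim: "(\<lambda>i. g i x) \<longlonglongrightarrow> \<bar>f x\<bar>" for x
    unfolding SUP using g(1,3) by (intro LIMSEQ_incseq_SUP) (auto simp: incseq_def le_fun_def)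
  have le: "g i x \<le> \<bar>f x\<bar>" for i x
    unfolding SUP using g(3) by (intro cSUP_upper) auto
  show ?thesis
  proof
    show "simple_function M (\<lambda>x. (if 0 \<le> f x then 1 else - 1) * g i x)" for i
      by (intro simple_function_mult simple_function_If simple_function_const g) auto
    show "(\<lambda>i. (if 0 \<le> f x then 1 else - 1) * g i x) \<longlonglongrightarrow> f x" for x
      using tendsto_mult_left[OF lim[of x], of "if 0 \<le> f x then 1 else - 1"]
        tendsto_minus[OF lim[of x]] by (cases "0 \<le> f x") simp_all
    show "\<bar>(if 0 \<le> f x then 1 else - 1) * g i x\<bar> \<le> \<bar>f x\<bar>" for i x
      using le[of i x] g(4)[of i x] by auto
  qed
qed

text \<open>
The factor at \<open>x\<close> is kept together with \<open>S x\<close> in the summand for \<open>x\<close>, and only the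
factors at the other points are replaced by \<open>Q\<close>. The bound then involves \<open>S * P\<close>
in place of \<open>S * Q\<close>.
\<close>

lemma abs_prod_sum_le:
  fixes P Q S :: "'a \<Rightarrow> real"
  assumes A: "finite A" and PQ: "\<And>x. x \<in> A \<Longrightarrow> \<bar>P x\<bar> \<le> Q x" and Q: "\<And>x. x \<in> A \<Longrightarrow> 0 < Q x"
  shows "\<bar>(\<Prod>x\<in>A. P x) * (\<Sum>x\<in>A. S x)\<bar> \<le> (\<Prod>x\<in>A. Q x) * (\<Sum>x\<in>A. \<bar>S x * P x\<bar> / Q x)"
proof -
  have "\<bar>(\<Prod>x\<in>A. P x) * (\<Sum>x\<in>A. S x)\<bar> \<le> (\<Sum>x\<in>A. \<bar>(\<Prod>y\<in>A. P y) * S x\<bar>)"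
    unfolding sum_distrib_left by (rule sum_abs)
  also have "\<dots> \<le> (\<Sum>x\<in>A. (\<Prod>y\<in>A. Q y) * (\<bar>S x * P x\<bar> / Q x))"
  proof (rule sum_mono)
    fix x assume x: "x \<in> A"
    have "\<bar>(\<Prod>y\<in>A. P y) * S x\<bar> = \<bar>S x * P x\<bar> * (\<Prod>y\<in>A - {x}. \<bar>P y\<bar>)"
      using A x by (simp add: prod.remove abs_mult abs_prod)
    also have "\<dots> \<le> \<bar>S x * P x\<bar> * (\<Prod>y\<in>A - {x}. Q y)"
      using PQ by (intro mult_left_mono prod_mono) auto
    also have "\<dots> = (\<Prod>y\<in>A. Q y) * (\<bar>S x * P x\<bar> / Q x)"
      using A x Q[OF x] by (simp add: prod.remove)
    finally show "\<bar>(\<Prod>y\<in>A. P y) * S x\<bar> \<le> (\<Prod>y\<in>A. Q y) * (\<bar>S x * P x\<bar> / Q x)" .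
  qed
  finally show ?thesis
    by (simp add: sum_distrib_left)
qed

section \<open>Counts and step functions\<close>

context homogeneous_poisson_process
begin

text \<open>
A Poisson expectation is a series. The density with respect to counting measure also covers the
degenerate parameter \<open>z = 0\<close>, where \<open>0 ^ 0 = 1\<close> puts all mass on \<open>0\<close>.
\<close>

lemma has_bochner_integral_count:
  fixes f :: "nat \<Rightarrow> real"
  assumes B: "B \<in> sets borel" "bounded B"
    and z: "z = lam * measure lborel B"
    and sm: "summable (\<lambda>n. \<bar>f n\<bar> * (exp (- z) * z ^ n / fact n))"
    and I: "(\<lambda>n. f n * (exp (- z) * z ^ n / fact n)) sums I"
  shows "has_bochner_integral M (\<lambda>\<omega>. f (card (\<Phi> \<omega> \<inter> B))) I"
proof -
  let ?N = "\<lambda>\<omega>. card (\<Phi> \<omega> \<inter> B)" and ?w = "\<lambda>n. exp (- z) * z ^ n / fact n"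
  have N[measurable]: "?N \<in> measurable M (count_space UNIV)"
    using count_measurable B by blast
  have z0: "0 \<le> z"
    using z intensity_nonneg by simp
  have distr: "distr M (count_space UNIV) ?N = density (count_space UNIV) (\<lambda>n. ennreal (?w n))"
  proof (rule measure_eqI_countable[of _ UNIV])
    fix n :: nat
    have "emeasure (distr M (count_space UNIV) ?N) {n} = emeasure M {\<omega> \<in> space M. ?N \<omega> = n}"
      by (subst emeasure_distr) (auto intro!: arg_cong[of _ _ "emeasure M"])
    also have "\<dots> = ennreal (?w n)"
      using count_poisson[OF B, of n] z by (simp add: emeasure_eq_measure)
    also have "\<dots> = emeasure (density (count_space UNIV) (\<lambda>n. ennreal (?w n))) {n}"
      by (subst emeasure_density) (auto simp: nn_integral_count_space_indicator[symmetric]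
          nn_integral_count_space_finite)
    finally show "emeasure (distr M (count_space UNIV) ?N) {n} =
        emeasure (density (count_space UNIV) (\<lambda>n. ennreal (?w n))) {n}" .
  qed auto
  have "integrable (count_space UNIV) (\<lambda>n. ?w n *\<^sub>R f n)"
    unfolding integrable_count_space_nat_iff using sm z0 by (simp add: abs_mult mult.commute)
  moreover from this have "(\<lambda>n. ?w n *\<^sub>R f n) sums integral\<^sup>L (count_space UNIV) (\<lambda>n. ?w n *\<^sub>R f n)"
    by (rule sums_integral_count_space_nat)
  then have "integral\<^sup>L (count_space UNIV) (\<lambda>n. ?w n *\<^sub>R f n) = I"
    using I by (auto simp: mult.commute intro: sums_unique2)
  ultimately have "has_bochner_integral (density (count_space UNIV) ?w) f I"
    using z0 by (intro has_bochner_integral_density) (auto simp: has_bochner_integral_iff)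
  then have "has_bochner_integral (distr M (count_space UNIV) ?N) f I"
    unfolding distr .
  then show ?thesis
    by (simp add: has_bochner_integral_iff integrable_distr_eq integral_distr)
qed

lemma has_bochner_integral_power_count:
  fixes p :: real
  assumes B: "B \<in> sets borel" "bounded B" and z: "z = lam * measure lborel B"
  shows "has_bochner_integral M (\<lambda>\<omega>. p ^ card (\<Phi> \<omega> \<inter> B)) (exp (z * (p - 1)))"
proof (rule has_bochner_integral_count[OF B z])
  have eq: "q ^ n * (exp (- z) * z ^ n / fact n) = exp (- z) * ((q * z) ^ n /\<^sub>R fact n)" for q :: real and n
    by (simp add: power_mult_distrib field_simps)
  have *: "(\<lambda>n. q ^ n * (exp (- z) * z ^ n / fact n)) sums (exp (- z) * exp (q * z))" for q :: real
    unfolding eq by (intro sums_mult exp_converges)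
  show "summable (\<lambda>n. \<bar>p ^ n\<bar> * (exp (- z) * z ^ n / fact n))"
    using *[of "\<bar>p\<bar>"] by (simp add: power_abs sums_iff)
  show "(\<lambda>n. p ^ n * (exp (- z) * z ^ n / fact n)) sums exp (z * (p - 1))"
    using *[of p] by (simp add: algebra_simps flip: exp_add)
qed

lemma has_bochner_integral_count_power_count:
  fixes p :: real
  assumes B: "B \<in> sets borel" "bounded B" and z: "z = lam * measure lborel B"
  shows "has_bochner_integral M (\<lambda>\<omega>. card (\<Phi> \<omega> \<inter> B) * p ^ card (\<Phi> \<omega> \<inter> B))
    (z * p * exp (z * (p - 1)))"
proof (rule has_bochner_integral_count[OF B z])
  have eq: "(real (Suc n) * q ^ Suc n) * (exp (- z) * z ^ Suc n / fact (Suc n)) =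
      q * z * exp (- z) * ((q * z) ^ n /\<^sub>R fact n)" for q :: real and n
    by (simp add: power_mult_distrib field_simps del: of_nat_Suc)
  have "(\<lambda>n. (real (Suc n) * q ^ Suc n) * (exp (- z) * z ^ Suc n / fact (Suc n)))
      sums (q * z * exp (- z) * exp (q * z))" for q :: real
    unfolding eq by (intro sums_mult exp_converges)
  then have *: "(\<lambda>n. (real n * q ^ n) * (exp (- z) * z ^ n / fact n))
      sums (q * z * exp (- z) * exp (q * z))" for q :: real
    by (subst (asm) sums_Suc_iff) simp
  show "summable (\<lambda>n. \<bar>real n * p ^ n\<bar> * (exp (- z) * z ^ n / fact n))"
    using *[of "\<bar>p\<bar>"] by (simp add: power_abs sums_iff abs_mult)
  show "(\<lambda>n. (real n * p ^ n) * (exp (- z) * z ^ n / fact n)) sums (z * p * exp (z * (p - 1)))"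
    using *[of p] by (simp add: algebra_simps flip: exp_add)
qed

text \<open>
In the term of the sum belonging to a cell \<open>j\<close>, the integrand is a product over the cells of
functions of the independent counts. Each cell contributes an exponential factor, and the cell
\<open>j\<close> the additional factor \<open>lam * measure lborel j * p j\<close>.
\<close>

lemma has_bochner_integral_partition:
  fixes p s :: "'a set \<Rightarrow> real"
  assumes fin: "finite \<B>" and disj: "disjoint \<B>"
    and B: "\<And>b. b \<in> \<B> \<Longrightarrow> b \<in> sets borel \<and> bounded b"
  shows "has_bochner_integral M
    (\<lambda>\<omega>. (\<Prod>b\<in>\<B>. p b ^ card (\<Phi> \<omega> \<inter> b)) * (\<Sum>b\<in>\<B>. s b * card (\<Phi> \<omega> \<inter> b)))
    (lam * (\<Sum>b\<in>\<B>. s b * p b * measure lborel b) *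
      exp (lam * (\<Sum>b\<in>\<B>. (p b - 1) * measure lborel b)))"
proof -
  let ?N = "\<lambda>b \<omega>. card (\<Phi> \<omega> \<inter> b)"
  have one: "has_bochner_integral M (\<lambda>\<omega>. (\<Prod>b\<in>\<B>. p b ^ ?N b \<omega>) * ?N j \<omega>)
      (lam * measure lborel j * p j * exp (lam * (\<Sum>b\<in>\<B>. (p b - 1) * measure lborel b)))"
    if j: "j \<in> \<B>" for j
  proof -
    define f where "f b n = (if b = j then real n else 1) * p b ^ n" for b n
    have ind: "indep_vars (\<lambda>_. borel) (\<lambda>b \<omega>. f b (?N b \<omega>)) \<B>"
      using count_indep[OF fin disj B] by (rule indep_vars_compose2) auto
    have E: "has_bochner_integral M (\<lambda>\<omega>. f b (?N b \<omega>))
        ((if b = j then lam * measure lborel b * p b else 1) *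
          exp (lam * measure lborel b * (p b - 1)))" if "b \<in> \<B>" for b
      using has_bochner_integral_power_count[of b _ "p b", OF _ _ refl] B[OF that]
        has_bochner_integral_count_power_count[of b _ "p b", OF _ _ refl]
      by (cases "b = j") (auto simp: f_def)
    have "integrable M (\<lambda>\<omega>. \<Prod>b\<in>\<B>. f b (?N b \<omega>))"
      using E by (intro indep_vars_integrable fin ind) (auto simp: has_bochner_integral_iff)
    moreover have "(LINT \<omega>|M. (\<Prod>b\<in>\<B>. f b (?N b \<omega>))) = (\<Prod>b\<in>\<B>. LINT \<omega>|M. f b (?N b \<omega>))"
      using E by (intro indep_vars_lebesgue_integral fin ind) (auto simp: has_bochner_integral_iff)
    moreover have "\<dots> = (\<Prod>b\<in>\<B>. (if b = j then lam * measure lborel b * p b else 1) *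
          exp (lam * measure lborel b * (p b - 1)))"
      using E by (intro prod.cong) (auto simp: has_bochner_integral_iff)
    moreover have "\<dots> = lam * measure lborel j * p j * exp (lam * (\<Sum>b\<in>\<B>. (p b - 1) * measure lborel b))"
      using fin j by (simp add: prod.distrib exp_sum sum_distrib_left mult_ac)
    moreover have "(\<Prod>b\<in>\<B>. f b (?N b \<omega>)) = (\<Prod>b\<in>\<B>. p b ^ ?N b \<omega>) * ?N j \<omega>" for \<omega>
      using fin j by (simp add: f_def prod.distrib prod.delta)
    ultimately show ?thesis
      by (simp add: has_bochner_integral_iff)
  qed
  have "has_bochner_integral M (\<lambda>\<omega>. \<Sum>j\<in>\<B>. s j * ((\<Prod>b\<in>\<B>. p b ^ ?N b \<omega>) * ?N j \<omega>))
      (\<Sum>j\<in>\<B>. s j * (lam * measure lborel j * p j *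
        exp (lam * (\<Sum>b\<in>\<B>. (p b - 1) * measure lborel b))))"
    using one by (intro has_bochner_integral_sum has_bochner_integral_mult_right) auto
  then show ?thesis
    by (simp add: sum_distrib_left sum_distrib_right mult_ac)
qed

text \<open>
The cells are the level sets of the pair \<open>(p, s)\<close> inside \<open>B\<close>. On each of them both
functions are constant, so the product and the sum depend on the points only through the counts.
\<close>

lemma has_bochner_integral_simple:
  fixes p s :: "'a \<Rightarrow> real"
  assumes p: "simple_function borel p" and s: "simple_function borel s"
    and B: "B \<in> sets borel" "bounded B"
  shows "has_bochner_integral M (\<lambda>\<omega>. (\<Prod>x\<in>\<Phi> \<omega> \<inter> B. p x) * (\<Sum>x\<in>\<Phi> \<omega> \<inter> B. s x))
    (lam * (LINT x:B|lborel. s x * p x) * exp (lam * (LINT x:B|lborel. p x - 1)))"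
proof -
  define g where "g x = (p x, s x)" for x
  define \<B> where "\<B> = (\<lambda>v. B \<inter> g -` {v}) ` g ` B"
  define r where "r b = g (SOME x. x \<in> b)" for b
  have g: "simple_function borel g"
    unfolding g_def using p s by (rule simple_function_Pair)
  have "finite (g ` B)"
    using g by (auto simp: simple_function_def intro: finite_subset[of _ "range g"])
  then have fin: "finite \<B>"
    by (simp add: \<B>_def)
  have disj: "disjoint \<B>"
    by (auto simp: \<B>_def disjoint_def)
  have bB: "b \<in> sets borel \<and> bounded b" if "b \<in> \<B>" for b
  proof -
    obtain v where v: "b = B \<inter> g -` {v}"
      using \<open>b \<in> \<B>\<close> unfolding \<B>_def by blast
    have "g -` {v} \<inter> space borel \<in> sets borel"
      using g by (rule simple_functionD(2))
    then show ?thesis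
      using B v by (auto intro: bounded_subset)
  qed
  have UB: "\<Union>\<B> = B"
    by (auto simp: \<B>_def)
  have r: "r b = g x" if "b \<in> \<B>" "x \<in> b" for b x
    using that someI[of "\<lambda>x. x \<in> b" x] by (auto simp: \<B>_def r_def)
  have r': "fst (r b) = p x" "snd (r b) = s x" if "b \<in> \<B>" "x \<in> b" for b x
    using r[OF that] by (auto simp: g_def)
  have int: "(LINT x:B|lborel. h (g x)) = (\<Sum>b\<in>\<B>. h (r b) * measure lborel b)" for h :: "real \<times> real \<Rightarrow> real"
  proof -
    have "(LINT x:B|lborel. h (g x)) = (LINT x|lborel. (\<Sum>b\<in>\<B>. indicator b x * h (r b)))"
      unfolding set_lebesgue_integral_def
    proof (intro Bochner_Integration.integral_cong refl)
      fix x
      show "indicator B x *\<^sub>R h (g x) = (\<Sum>b\<in>\<B>. indicator b x * h (r b))"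
      proof (cases "x \<in> B")
        case True
        then obtain b where b: "b \<in> \<B>" "x \<in> b"
          using UB by blast
        have "(\<Sum>b\<in>\<B>. indicator b x * h (r b)) = (\<Sum>b\<in>{b}. indicator b x * h (r b))"
          using fin b disj by (intro sum.mono_neutral_right) (auto simp: disjoint_def indicator_def)
        then show ?thesis
          using b r True by simp
      next
        case False
        then have "x \<notin> b" if "b \<in> \<B>" for b
          using that UB by auto
        then show ?thesis
          using False by simp
      qed
    qed
    also have "\<dots> = (\<Sum>b\<in>\<B>. h (r b) * measure lborel b)"
    proof -
      have "integrable lborel (\<lambda>x. indicator b x * h (r b))" if "b \<in> \<B>" for b
        using bB[OF that] by (intro integrable_mult_left integrable_real_indicator emeasure_bounded_finite) auto
      then show ?thesis
        by (simp add: mult.commute)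
    qed
    finally show ?thesis .
  qed
  have split: "\<Phi> \<omega> \<inter> B = (\<Union>b\<in>\<B>. \<Phi> \<omega> \<inter> b)" for \<omega>
    using UB by auto
  have prod: "(\<Prod>x\<in>\<Phi> \<omega> \<inter> B. p x) = (\<Prod>b\<in>\<B>. fst (r b) ^ card (\<Phi> \<omega> \<inter> b))"
    and sum: "(\<Sum>x\<in>\<Phi> \<omega> \<inter> B. s x) = (\<Sum>b\<in>\<B>. snd (r b) * card (\<Phi> \<omega> \<inter> b))"
    if \<omega>: "\<omega> \<in> space M" for \<omega>
  proof -
    have f: "\<forall>b\<in>\<B>. finite (\<Phi> \<omega> \<inter> b)"
      using locally_finite[OF \<omega>] bB by blast
    have d: "\<forall>b\<in>\<B>. \<forall>c\<in>\<B>. b \<noteq> c \<longrightarrow> \<Phi> \<omega> \<inter> b \<inter> (\<Phi> \<omega> \<inter> c) = {}"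
      using disj by (auto simp: disjoint_def)
    have "(\<Prod>x\<in>\<Phi> \<omega> \<inter> B. p x) = (\<Prod>b\<in>\<B>. \<Prod>x\<in>\<Phi> \<omega> \<inter> b. p x)"
      unfolding split using fin f d by (rule prod.UNION_disjoint)
    also have "\<dots> = (\<Prod>b\<in>\<B>. \<Prod>x\<in>\<Phi> \<omega> \<inter> b. fst (r b))"
      using r' by (intro prod.cong) auto
    finally show "(\<Prod>x\<in>\<Phi> \<omega> \<inter> B. p x) = (\<Prod>b\<in>\<B>. fst (r b) ^ card (\<Phi> \<omega> \<inter> b))" by simp
    have "(\<Sum>x\<in>\<Phi> \<omega> \<inter> B. s x) = (\<Sum>b\<in>\<B>. \<Sum>x\<in>\<Phi> \<omega> \<inter> b. s x)"
      unfolding split using fin f d by (rule sum.UNION_disjoint)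
    also have "\<dots> = (\<Sum>b\<in>\<B>. \<Sum>x\<in>\<Phi> \<omega> \<inter> b. snd (r b))"
      using r' by (intro sum.cong) auto
    finally show "(\<Sum>x\<in>\<Phi> \<omega> \<inter> B. s x) = (\<Sum>b\<in>\<B>. snd (r b) * card (\<Phi> \<omega> \<inter> b))"
      by (simp add: mult.commute)
  qed
  have "has_bochner_integral M
    (\<lambda>\<omega>. (\<Prod>b\<in>\<B>. fst (r b) ^ card (\<Phi> \<omega> \<inter> b)) * (\<Sum>b\<in>\<B>. snd (r b) * card (\<Phi> \<omega> \<inter> b)))
    (lam * (\<Sum>b\<in>\<B>. snd (r b) * fst (r b) * measure lborel b) *
      exp (lam * (\<Sum>b\<in>\<B>. (fst (r b) - 1) * measure lborel b)))"
    using fin disj bB by (rule has_bochner_integral_partition)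
  moreover have "(\<Sum>b\<in>\<B>. snd (r b) * fst (r b) * measure lborel b) = (LINT x:B|lborel. s x * p x)"
    using int[of "\<lambda>v. snd v * fst v"] by (simp add: g_def)
  moreover have "(\<Sum>b\<in>\<B>. (fst (r b) - 1) * measure lborel b) = (LINT x:B|lborel. p x - 1)"
    using int[of "\<lambda>v. fst v - 1"] by (simp add: g_def)
  ultimately show ?thesis
    by (subst has_bochner_integral_cong[OF refl _ refl, where g = "\<lambda>\<omega>.
      (\<Prod>b\<in>\<B>. fst (r b) ^ card (\<Phi> \<omega> \<inter> b)) * (\<Sum>b\<in>\<B>. snd (r b) * card (\<Phi> \<omega> \<inter> b))"])
      (simp_all add: prod sum)
qed

section \<open>Measurable functions on a bounded window\<close>

lemma prod_sum_simple_approx: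
  fixes P S :: "'a \<Rightarrow> real"
  assumes P: "P \<in> borel_measurable borel" and S: "S \<in> borel_measurable borel"
  obtains p s where "\<And>i. simple_function borel (p i)" "\<And>i. simple_function borel (s i)"
    "\<And>x. (\<lambda>i. p i x) \<longlonglongrightarrow> P x" "\<And>x. (\<lambda>i. s i x) \<longlonglongrightarrow> S x"
    "\<And>i x. \<bar>p i x\<bar> \<le> \<bar>P x\<bar>" "\<And>i x. \<bar>s i x\<bar> \<le> \<bar>S x\<bar>"
    "\<And>\<omega>. (\<lambda>i. (\<Prod>x\<in>\<Phi> \<omega> \<inter> B. p i x) * (\<Sum>x\<in>\<Phi> \<omega> \<inter> B. s i x))
      \<longlonglongrightarrow> (\<Prod>x\<in>\<Phi> \<omega> \<inter> B. P x) * (\<Sum>x\<in>\<Phi> \<omega> \<inter> B. S x)"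
proof -
  obtain p where p: "\<And>i. simple_function borel (p i)" "\<And>x. (\<lambda>i. p i x) \<longlonglongrightarrow> P x"
    "\<And>i x. \<bar>p i x\<bar> \<le> \<bar>P x\<bar>"
    using simple_function_approx_abs_le[OF P] by metis
  obtain s where s: "\<And>i. simple_function borel (s i)" "\<And>x. (\<lambda>i. s i x) \<longlonglongrightarrow> S x"
    "\<And>i x. \<bar>s i x\<bar> \<le> \<bar>S x\<bar>"
    using simple_function_approx_abs_le[OF S] by metis
  show thesis
    by (rule that[OF p(1) s(1) p(2) s(2) p(3) s(3)]) (intro tendsto_intros p s)
qed

text \<open>
The counts are measurable in \<open>\<omega>\<close>, hence so is the expression for step functions, and
pointwise limits preserve measurability.
\<close>

lemma prod_sum_bounded_measurable:
  fixes P S :: "'a \<Rightarrow> real"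
  assumes "P \<in> borel_measurable borel" "S \<in> borel_measurable borel"
    and B: "B \<in> sets borel" "bounded B"
  shows "(\<lambda>\<omega>. (\<Prod>x\<in>\<Phi> \<omega> \<inter> B. P x) * (\<Sum>x\<in>\<Phi> \<omega> \<inter> B. S x)) \<in> borel_measurable M"
proof -
  obtain p s where ps: "\<And>i. simple_function borel (p i)" "\<And>i. simple_function borel (s i)"
    "\<And>\<omega>. (\<lambda>i. (\<Prod>x\<in>\<Phi> \<omega> \<inter> B. p i x) * (\<Sum>x\<in>\<Phi> \<omega> \<inter> B. s i x))
      \<longlonglongrightarrow> (\<Prod>x\<in>\<Phi> \<omega> \<inter> B. P x) * (\<Sum>x\<in>\<Phi> \<omega> \<inter> B. S x)"
    by (rule prod_sum_simple_approx[OF assms(1,2), where B = B]) (rule that)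
  show ?thesis
  proof (rule borel_measurable_LIMSEQ_real[OF ps(3)])
    show "(\<lambda>\<omega>. (\<Prod>x\<in>\<Phi> \<omega> \<inter> B. p i x) * (\<Sum>x\<in>\<Phi> \<omega> \<inter> B. s i x)) \<in> borel_measurable M" for i
      using has_bochner_integral_simple[OF ps(1,2) B]
      by (auto simp: has_bochner_integral_iff dest: borel_measurable_integrable)
  qed
qed

lemma set_integrable_const_bounded:
  "B \<in> sets borel \<Longrightarrow> bounded B \<Longrightarrow> set_integrable lborel B (\<lambda>_::'a. c::real)"
  unfolding set_integrable_def
  by (intro integrable_scaleR_left integrable_real_indicator)
     (use emeasure_bounded_finite in auto)

text \<open>
Approximate \<open>P\<close> and \<open>S\<close> by step functions bounded by \<open>\<bar>P\<bar>\<close> and \<open>\<bar>S\<bar>\<close>. The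
random variable \<open>G\<close> that belongs to \<open>\<bar>P\<bar>\<close> and \<open>\<bar>S\<bar>\<close> dominates all the approximants.
Its expectation is finite by Fatou's lemma, because the formula for step functions bounds the
expectations of its own approximants uniformly.
\<close>

lemma has_bochner_integral_bounded:
  fixes P S :: "'a \<Rightarrow> real"
  assumes P[measurable]: "P \<in> borel_measurable borel" and S[measurable]: "S \<in> borel_measurable borel"
    and B: "B \<in> sets borel" "bounded B"
    and intP: "set_integrable lborel B P" and intSP: "set_integrable lborel B (\<lambda>x. S x * P x)"
  shows "has_bochner_integral M (\<lambda>\<omega>. (\<Prod>x\<in>\<Phi> \<omega> \<inter> B. P x) * (\<Sum>x\<in>\<Phi> \<omega> \<inter> B. S x))
    (lam * (LINT x:B|lborel. S x * P x) * exp (lam * (LINT x:B|lborel. P x - 1)))"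
proof -
  note [measurable] = B(1)
  obtain p s where sf: "\<And>i. simple_function borel (p i)" "\<And>i. simple_function borel (s i)"
    and lim: "\<And>x. (\<lambda>i. p i x) \<longlonglongrightarrow> P x" "\<And>x. (\<lambda>i. s i x) \<longlonglongrightarrow> S x"
    and le: "\<And>i x. \<bar>p i x\<bar> \<le> \<bar>P x\<bar>" "\<And>i x. \<bar>s i x\<bar> \<le> \<bar>S x\<bar>"
    and limF: "\<And>\<omega>. (\<lambda>i. (\<Prod>x\<in>\<Phi> \<omega> \<inter> B. p i x) * (\<Sum>x\<in>\<Phi> \<omega> \<inter> B. s i x))
      \<longlonglongrightarrow> (\<Prod>x\<in>\<Phi> \<omega> \<inter> B. P x) * (\<Sum>x\<in>\<Phi> \<omega> \<inter> B. S x)"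
    by (rule prod_sum_simple_approx[OF P S, where B = B]) (rule that)
  have [measurable]: "p i \<in> borel_measurable borel" "s i \<in> borel_measurable borel" for i
    using sf by (auto intro: borel_measurable_simple_function)
  have le_mult: "\<bar>s i x\<bar> * \<bar>p i x\<bar> \<le> \<bar>S x\<bar> * \<bar>P x\<bar>" for i x
    using le by (intro mult_mono) auto
  have one: "set_integrable lborel B (\<lambda>_. 1 :: real)"
    using B by (rule set_integrable_const_bounded)
  have intp: "set_integrable lborel B (p i)" for i
    using intP by (rule set_integrable_bound) (auto simp: set_borel_measurable_def le)
  have intsp: "set_integrable lborel B (\<lambda>x. s i x * p i x)" for i
    using intSP by (rule set_integrable_bound)
      (auto simp: set_borel_measurable_def abs_mult le_mult)
  define G where "G \<omega> = (\<Prod>x\<in>\<Phi> \<omega> \<inter> B. \<bar>P x\<bar>) * (\<Sum>x\<in>\<Phi> \<omega> \<inter> B. \<bar>S x\<bar>)" for \<omega>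
  define Gi where "Gi i \<omega> = (\<Prod>x\<in>\<Phi> \<omega> \<inter> B. \<bar>p i x\<bar>) * (\<Sum>x\<in>\<Phi> \<omega> \<inter> B. \<bar>s i x\<bar>)" for i \<omega>
  define C where "C = lam * (LINT x:B|lborel. \<bar>S x * P x\<bar>) * exp (lam * (LINT x:B|lborel. \<bar>P x\<bar> - 1))"
  have G_meas[measurable]: "G \<in> borel_measurable M"
    unfolding G_def using B by (intro prod_sum_bounded_measurable) auto
  have G_nonneg: "0 \<le> G \<omega>" "0 \<le> Gi i \<omega>" for i \<omega>
    unfolding G_def Gi_def by (auto intro!: mult_nonneg_nonneg prod_nonneg sum_nonneg)
  have Gi: "has_bochner_integral M (Gi i)
      (lam * (LINT x:B|lborel. \<bar>s i x\<bar> * \<bar>p i x\<bar>) * exp (lam * (LINT x:B|lborel. \<bar>p i x\<bar> - 1)))" for i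
    unfolding Gi_def
    by (intro has_bochner_integral_simple B simple_function_compose1[OF sf(1), of abs]
        simple_function_compose1[OF sf(2), of abs])
  have Gi_meas[measurable]: "Gi i \<in> borel_measurable M" for i
    using Gi[of i] by (auto simp: has_bochner_integral_iff dest: borel_measurable_integrable)
  have Gi_le: "integral\<^sup>N M (\<lambda>\<omega>. ennreal (Gi i \<omega>)) \<le> ennreal C" for i
  proof -
    have "integral\<^sup>N M (\<lambda>\<omega>. ennreal (Gi i \<omega>)) = ennreal (integral\<^sup>L M (Gi i))"
      using Gi G_nonneg by (intro nn_integral_eq_integral) (auto simp: has_bochner_integral_iff)
    also have "integral\<^sup>L M (Gi i) =
      lam * (LINT x:B|lborel. \<bar>s i x\<bar> * \<bar>p i x\<bar>) * exp (lam * (LINT x:B|lborel. \<bar>p i x\<bar> - 1))"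
      using Gi by (simp add: has_bochner_integral_iff)
    also have "\<dots> \<le> C"
    proof -
      have "(LINT x:B|lborel. \<bar>s i x\<bar> * \<bar>p i x\<bar>) \<le> (LINT x:B|lborel. \<bar>S x * P x\<bar>)"
        using set_integrable_abs[OF intsp[of i]] set_integrable_abs[OF intSP] le_mult
        by (intro set_integral_mono) (auto simp: abs_mult)
      moreover have "(LINT x:B|lborel. \<bar>p i x\<bar> - 1) \<le> (LINT x:B|lborel. \<bar>P x\<bar> - 1)"
        using le by (intro set_integral_mono set_integral_diff set_integrable_abs intp intP one) auto
      moreover have "0 \<le> (LINT x:B|lborel. \<bar>s i x\<bar> * \<bar>p i x\<bar>)"
        unfolding set_lebesgue_integral_def by (intro integral_nonneg_AE) auto
      ultimately show ?thesis
        unfolding C_def using intensity_nonneg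
        by (intro mult_mono mult_left_mono mult_nonneg_nonneg) (auto intro!: mult_left_mono)
    qed
    finally show ?thesis
      by (simp add: ennreal_leI)
  qed
  have "integral\<^sup>N M (\<lambda>\<omega>. ennreal (G \<omega>)) = integral\<^sup>N M (\<lambda>\<omega>. liminf (\<lambda>i. ennreal (Gi i \<omega>)))"
  proof (intro nn_integral_cong)
    fix \<omega>
    have "(\<lambda>i. Gi i \<omega>) \<longlonglongrightarrow> G \<omega>"
      unfolding G_def Gi_def by (intro tendsto_intros lim)
    then have "(\<lambda>i. ennreal (Gi i \<omega>)) \<longlonglongrightarrow> ennreal (G \<omega>)"
      by (rule tendsto_ennrealI)
    then show "ennreal (G \<omega>) = liminf (\<lambda>i. ennreal (Gi i \<omega>))"
      by (simp add: lim_imp_Liminf)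
  qed
  also have "\<dots> \<le> liminf (\<lambda>i. integral\<^sup>N M (\<lambda>\<omega>. ennreal (Gi i \<omega>)))"
    by (intro nn_integral_liminf) measurable
  also have "\<dots> \<le> limsup (\<lambda>i. integral\<^sup>N M (\<lambda>\<omega>. ennreal (Gi i \<omega>)))"
    by (intro Liminf_le_Limsup sequentially_bot)
  also have "\<dots> \<le> ennreal C"
    using Gi_le by (intro Limsup_bounded) auto
  finally have intG: "integrable M G"
    using G_nonneg by (intro integrableI_bounded) (auto simp: le_less_trans[OF _ ennreal_less_top])
  let ?F = "\<lambda>\<omega>. (\<Prod>x\<in>\<Phi> \<omega> \<inter> B. P x) * (\<Sum>x\<in>\<Phi> \<omega> \<inter> B. S x)"
  let ?Fi = "\<lambda>i \<omega>. (\<Prod>x\<in>\<Phi> \<omega> \<inter> B. p i x) * (\<Sum>x\<in>\<Phi> \<omega> \<inter> B. s i x)"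
  have Fi: "has_bochner_integral M (?Fi i)
      (lam * (LINT x:B|lborel. s i x * p i x) * exp (lam * (LINT x:B|lborel. p i x - 1)))" for i
    by (rule has_bochner_integral_simple[OF sf B])
  have Fi_le: "norm (?Fi i \<omega>) \<le> G \<omega>" for i \<omega>
    unfolding G_def real_norm_def abs_mult abs_prod
    using le by (intro mult_mono prod_mono order_trans[OF sum_abs] sum_mono) (auto intro: prod_nonneg)
  have F_meas: "?F \<in> borel_measurable M"
    using B by (intro prod_sum_bounded_measurable) auto
  have Fi_meas: "?Fi i \<in> borel_measurable M" for i
    using Fi by (auto simp: has_bochner_integral_iff dest: borel_measurable_integrable)
  have intF: "integrable M ?F"
    by (rule integrable_dominated_convergence[where s = ?Fi and w = G, OF F_meas Fi_meas intG]) (use limF Fi_le in auto)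
  have limint: "(\<lambda>i. integral\<^sup>L M (?Fi i)) \<longlonglongrightarrow> integral\<^sup>L M ?F"
    by (rule integral_dominated_convergence[where w = G, OF F_meas Fi_meas intG]) (use limF Fi_le in auto)
  have "(\<lambda>i. LINT x:B|lborel. s i x * p i x) \<longlonglongrightarrow> (LINT x:B|lborel. S x * P x)"
    unfolding set_lebesgue_integral_def
  proof (rule integral_dominated_convergence)
    show "integrable lborel (\<lambda>x. indicator B x *\<^sub>R \<bar>S x * P x\<bar>)"
      using set_integrable_abs[OF intSP] by (simp add: set_integrable_def)
    show "AE x in lborel. (\<lambda>i. indicator B x *\<^sub>R (s i x * p i x)) \<longlonglongrightarrow> indicator B x *\<^sub>R (S x * P x)"
      by (intro AE_I2 tendsto_intros lim)
    show "AE x in lborel. norm (indicator B x *\<^sub>R (s i x * p i x)) \<le> indicator B x *\<^sub>R \<bar>S x * P x\<bar>" for i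
      using le_mult by (auto simp: abs_mult indicator_def)
  qed auto
  moreover have "(\<lambda>i. LINT x:B|lborel. p i x - 1) \<longlonglongrightarrow> (LINT x:B|lborel. P x - 1)"
    unfolding set_lebesgue_integral_def
  proof (rule integral_dominated_convergence)
    have "set_integrable lborel B (\<lambda>x. \<bar>P x\<bar> + 1)"
      by (intro set_integral_add set_integrable_abs intP one)
    then show "integrable lborel (\<lambda>x. indicator B x *\<^sub>R (\<bar>P x\<bar> + 1))"
      by (simp add: set_integrable_def)
    show "AE x in lborel. (\<lambda>i. indicator B x *\<^sub>R (p i x - 1)) \<longlonglongrightarrow> indicator B x *\<^sub>R (P x - 1)"
      by (intro AE_I2 tendsto_intros lim)
    show "AE x in lborel. norm (indicator B x *\<^sub>R (p i x - 1)) \<le> indicator B x *\<^sub>R (\<bar>P x\<bar> + 1)" for i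
    proof (intro AE_I2)
      fix x
      have "\<bar>p i x - 1\<bar> \<le> \<bar>P x\<bar> + 1"
        using le(1)[of i x] by linarith
      then show "norm (indicator B x *\<^sub>R (p i x - 1)) \<le> indicator B x *\<^sub>R (\<bar>P x\<bar> + 1)"
        by (simp add: indicator_def)
    qed
  qed auto
  ultimately have "(\<lambda>i. integral\<^sup>L M (?Fi i)) \<longlonglongrightarrow>
      lam * (LINT x:B|lborel. S x * P x) * exp (lam * (LINT x:B|lborel. P x - 1))"
    using Fi by (simp add: has_bochner_integral_iff) (intro tendsto_intros)
  from LIMSEQ_unique[OF limint this] intF show ?thesis
    by (simp add: has_bochner_integral_iff)
qed

lemma summable_on_points_measurable:
  fixes S :: "'a \<Rightarrow> real"
  assumes [measurable]: "S \<in> borel_measurable borel"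
  shows "Measurable.pred M (\<lambda>\<omega>. S summable_on \<Phi> \<omega>)"
proof -
  have [measurable]: "(\<lambda>\<omega>. \<Sum>x\<in>\<Phi> \<omega> \<inter> cball 0 (real k). \<bar>S x\<bar>) \<in> borel_measurable M" for k
    using prod_sum_bounded_measurable[of "\<lambda>_. 1" "\<lambda>x. \<bar>S x\<bar>" "cball 0 (real k)"] by simp
  have "Measurable.pred M (\<lambda>\<omega>. (SUP k. ennreal (\<Sum>x\<in>\<Phi> \<omega> \<inter> cball 0 (real k). \<bar>S x\<bar>)) \<noteq> \<infinity>)"
    by measurable
  moreover have "S summable_on \<Phi> \<omega> \<longleftrightarrow> (SUP k. ennreal (\<Sum>x\<in>\<Phi> \<omega> \<inter> cball 0 (real k). \<bar>S x\<bar>)) \<noteq> \<infinity>"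
    if "\<omega> \<in> space M" for \<omega>
    using that locally_finite by (intro summable_on_iff_SUP_cball) auto
  ultimately show ?thesis
    by (simp cong: measurable_cong)
qed

text \<open>
Campbell's formula: taking \<open>P = 1\<close> on a window shows that the sum of \<open>\<bar>f\<bar>\<close> over the points
in a ball has expectation at most \<open>lam\<close> times the integral of \<open>\<bar>f\<bar>\<close>. By monotone
convergence the supremum over all balls has finite expectation, so it is almost surely finite.
\<close>

lemma AE_summable_on:
  fixes f :: "'a \<Rightarrow> real"
  assumes f: "integrable lborel f"
  shows "AE \<omega> in M. f summable_on \<Phi> \<omega>"
proof -
  have [measurable]: "f \<in> borel_measurable borel"
    using borel_measurable_integrable[OF f] by simp
  define X where "X k \<omega> = (\<Sum>x\<in>\<Phi> \<omega> \<inter> cball 0 (real k). \<bar>f x\<bar>)" for k \<omega>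
  have X: "has_bochner_integral M (X k) (lam * (LINT x:cball 0 (real k)|lborel. \<bar>f x\<bar>))" for k
  proof -
    have "set_integrable lborel (cball 0 (real k)) (\<lambda>x. \<bar>f x\<bar>)"
      unfolding set_integrable_def using f by (intro integrable_mult_indicator integrable_abs) auto
    then show ?thesis
      using has_bochner_integral_bounded[of "\<lambda>_. 1" "\<lambda>x. \<bar>f x\<bar>" "cball 0 (real k)"]
        set_integrable_const_bounded[of "cball 0 (real k)" 1]
      by (simp add: X_def[abs_def])
  qed
  have X_meas[measurable]: "X k \<in> borel_measurable M" for k
    using X by (auto simp: has_bochner_integral_iff dest: borel_measurable_integrable)
  have X_nonneg: "0 \<le> X k \<omega>" for k \<omega>
    by (auto simp: X_def intro: sum_nonneg)
  have "(\<integral>\<^sup>+\<omega>. (SUP k. ennreal (X k \<omega>)) \<partial>M) = (SUP k. \<integral>\<^sup>+\<omega>. ennreal (X k \<omega>) \<partial>M)"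
  proof (rule nn_integral_monotone_convergence_SUP_AE)
    show "AE \<omega> in M. ennreal (X k \<omega>) \<le> ennreal (X (Suc k) \<omega>)" for k
      using locally_finite unfolding X_def
      by (intro AE_I2 ennreal_leI sum_mono2) auto
  qed auto
  also have "\<dots> \<le> ennreal (lam * (LINT x|lborel. \<bar>f x\<bar>))"
  proof (rule SUP_least)
    fix k
    have "(\<integral>\<^sup>+\<omega>. ennreal (X k \<omega>) \<partial>M) = ennreal (lam * (LINT x:cball 0 (real k)|lborel. \<bar>f x\<bar>))"
      using X[of k] X_nonneg
      by (subst nn_integral_eq_integral) (auto simp: has_bochner_integral_iff)
    also have "\<dots> \<le> ennreal (lam * (LINT x|lborel. \<bar>f x\<bar>))"
      unfolding set_lebesgue_integral_def using f intensity_nonneg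
      by (intro ennreal_leI mult_left_mono integral_mono integrable_mult_indicator integrable_abs)
        (auto simp: indicator_def)
    finally show "(\<integral>\<^sup>+\<omega>. ennreal (X k \<omega>) \<partial>M) \<le> ennreal (lam * (LINT x|lborel. \<bar>f x\<bar>))" .
  qed
  finally have "(\<integral>\<^sup>+\<omega>. (SUP k. ennreal (X k \<omega>)) \<partial>M) \<noteq> \<infinity>"
    using neq_top_trans[OF ennreal_neq_top] unfolding infinity_ennreal_def by blast
  then have "AE \<omega> in M. (SUP k. ennreal (X k \<omega>)) \<noteq> \<infinity>"
    by (intro nn_integral_noteq_infinite) auto
  then show ?thesis
  proof (rule AE_mp, intro AE_I2 impI)
    fix \<omega> assume "\<omega> \<in> space M" "(SUP k. ennreal (X k \<omega>)) \<noteq> \<infinity>"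
    then show "f summable_on \<Phi> \<omega>"
      using locally_finite by (subst summable_on_iff_SUP_cball) (auto simp: X_def)
  qed
qed

section \<open>Exhausting the space\<close>

lemma prod_sum_cball_tendsto:
  fixes P S :: "'a \<Rightarrow> real"
  assumes \<omega>: "\<omega> \<in> space M" and P: "(\<lambda>x. \<bar>P x - 1\<bar>) summable_on \<Phi> \<omega>" and S: "S summable_on \<Phi> \<omega>"
  shows "(\<lambda>k. (\<Prod>x\<in>\<Phi> \<omega> \<inter> cball 0 (real k). P x) * (\<Sum>x\<in>\<Phi> \<omega> \<inter> cball 0 (real k). S x))
    \<longlonglongrightarrow> infprod P (\<Phi> \<omega>) * (\<Sum>\<^sub>\<infinity>x\<in>\<Phi> \<omega>. S x)"
proof -
  have flt: "filterlim (\<lambda>k. \<Phi> \<omega> \<inter> cball 0 (real k)) (finite_subsets_at_top (\<Phi> \<omega>)) sequentially"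
    using locally_finite[OF \<omega>] by (intro filterlim_cball_finite_subsets) auto
  show ?thesis
    using has_infprod_infprod[OF P] unfolding has_infprod_def
    by (intro tendsto_mult filterlim_compose[OF _ flt] infsum_tendsto[OF S])
qed

text \<open>
Measurability must hold for the values on the exceptional null sets as well, since \<open>M\<close> need not be
complete. Where \<open>S\<close> is not summable the value is \<open>0\<close>. Where only \<open>\<bar>P - 1\<bar>\<close> is
not summable, \<^const>\<open>infprod\<close> has its default value \<open>1\<close> and the value is the sum of \<open>S\<close>,
that is, the same expression for the constant factor \<open>1\<close>.
\<close>

lemma infprod_infsum_measurable:
  fixes P S :: "'a \<Rightarrow> real"
  assumes P[measurable]: "P \<in> borel_measurable borel" and S[measurable]: "S \<in> borel_measurable borel"
  shows "(\<lambda>\<omega>. infprod P (\<Phi> \<omega>) * (\<Sum>\<^sub>\<infinity>x\<in>\<Phi> \<omega>. S x)) \<in> borel_measurable M"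
proof -
  define F where "F p k \<omega> = (\<Prod>x\<in>\<Phi> \<omega> \<inter> cball 0 (real k). p x) * (\<Sum>x\<in>\<Phi> \<omega> \<inter> cball 0 (real k). S x)"
    for p :: "'a \<Rightarrow> real" and k \<omega>
  have [measurable]: "F P k \<in> borel_measurable M" "F (\<lambda>_. 1) k \<in> borel_measurable M" for k
    unfolding F_def by (intro prod_sum_bounded_measurable; simp)+
  have [measurable]: "Measurable.pred M (\<lambda>\<omega>. S summable_on \<Phi> \<omega>)"
    "Measurable.pred M (\<lambda>\<omega>. (\<lambda>x. \<bar>P x - 1\<bar>) summable_on \<Phi> \<omega>)"
    by (intro summable_on_points_measurable; simp)+
  have "(\<lambda>\<omega>. if S summable_on \<Phi> \<omega> then
      if (\<lambda>x. \<bar>P x - 1\<bar>) summable_on \<Phi> \<omega> then lim (\<lambda>k. F P k \<omega>) else lim (\<lambda>k. F (\<lambda>_. 1) k \<omega>)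
      else 0) \<in> borel_measurable M"
    by measurable
  also have "?this \<longleftrightarrow> ?thesis"
  proof (rule measurable_cong)
    fix \<omega> assume \<omega>: "\<omega> \<in> space M"
    have "lim (\<lambda>k. F P k \<omega>) = infprod P (\<Phi> \<omega>) * (\<Sum>\<^sub>\<infinity>x\<in>\<Phi> \<omega>. S x)"
      if "S summable_on \<Phi> \<omega>" "(\<lambda>x. \<bar>P x - 1\<bar>) summable_on \<Phi> \<omega>"
      unfolding F_def by (rule limI[OF prod_sum_cball_tendsto[OF \<omega> that(2,1)]])
    moreover have "lim (\<lambda>k. F (\<lambda>_. 1) k \<omega>) = infprod P (\<Phi> \<omega>) * (\<Sum>\<^sub>\<infinity>x\<in>\<Phi> \<omega>. S x)"
      if "S summable_on \<Phi> \<omega>" "\<not> (\<lambda>x. \<bar>P x - 1\<bar>) summable_on \<Phi> \<omega>"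
    proof -
      have "(\<lambda>k. F (\<lambda>_. 1) k \<omega>) \<longlonglongrightarrow> infprod (\<lambda>_. 1) (\<Phi> \<omega>) * (\<Sum>\<^sub>\<infinity>x\<in>\<Phi> \<omega>. S x)"
        unfolding F_def by (intro prod_sum_cball_tendsto \<omega> that) simp
      moreover have "infprod (\<lambda>_. 1) (\<Phi> \<omega>) = 1"
      proof -
        have "prod (\<lambda>_. 1 :: real) = (\<lambda>X :: 'a set. 1)"
          by (simp add: fun_eq_iff)
        then show ?thesis
          by (simp add: infprod_def tendsto_Lim)
      qed
      ultimately show ?thesis
        using that(2) by (simp add: infprod_def limI)
    qed
    ultimately show "(if S summable_on \<Phi> \<omega> then
      if (\<lambda>x. \<bar>P x - 1\<bar>) summable_on \<Phi> \<omega> then lim (\<lambda>k. F P k \<omega>) else lim (\<lambda>k. F (\<lambda>_. 1) k \<omega>)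
      else 0) = infprod P (\<Phi> \<omega>) * (\<Sum>\<^sub>\<infinity>x\<in>\<Phi> \<omega>. S x)"
      by (auto simp: infsum_not_exists)
  qed
  finally show ?thesis .
qed

context
  fixes P S :: "'a \<Rightarrow> real"
  assumes P[measurable]: "P \<in> borel_measurable borel" and S[measurable]: "S \<in> borel_measurable borel"
    and intP: "integrable lborel (\<lambda>x. P x - 1)" and intSP: "integrable lborel (\<lambda>x. S x * P x)"
begin

lemma AE_summable_deviation: "AE \<omega> in M. (\<lambda>x. \<bar>P x - 1\<bar>) summable_on \<Phi> \<omega>"
  using intP by (intro AE_summable_on integrable_abs)

lemma AE_summable_summand: "AE \<omega> in M. S summable_on \<Phi> \<omega>"
proof -
  have "AE \<omega> in M. (\<lambda>x. \<bar>S x * P x\<bar>) summable_on \<Phi> \<omega>"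
    using intSP by (intro AE_summable_on integrable_abs)
  then show ?thesis
    using AE_summable_deviation by eventually_elim (rule summable_on_cancel_factor)
qed

lemma AE_prod_sum_cball_tendsto:
  "AE \<omega> in M. (\<lambda>k. (\<Prod>x\<in>\<Phi> \<omega> \<inter> cball 0 (real k). P x) * (\<Sum>x\<in>\<Phi> \<omega> \<inter> cball 0 (real k). S x))
    \<longlonglongrightarrow> infprod P (\<Phi> \<omega>) * (\<Sum>\<^sub>\<infinity>x\<in>\<Phi> \<omega>. S x)"
  using AE_summable_deviation AE_summable_summand AE_space
  by eventually_elim (rule prod_sum_cball_tendsto)

lemma has_bochner_integral_cball:
  "has_bochner_integral M
    (\<lambda>\<omega>. (\<Prod>x\<in>\<Phi> \<omega> \<inter> cball 0 (real k). P x) * (\<Sum>x\<in>\<Phi> \<omega> \<inter> cball 0 (real k). S x))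
    (lam * (LINT x:cball 0 (real k)|lborel. S x * P x) *
      exp (lam * (LINT x:cball 0 (real k)|lborel. P x - 1)))"
proof (rule has_bochner_integral_bounded)
  have "set_integrable lborel (cball 0 (real k)) (\<lambda>x. (P x - 1) + 1)"
    by (intro set_integral_add set_integrable_const_bounded)
      (auto simp: set_integrable_def intro!: integrable_mult_indicator[OF _ intP, simplified])
  then show "set_integrable lborel (cball 0 (real k)) P"
    by simp
  show "set_integrable lborel (cball 0 (real k)) (\<lambda>x. S x * P x)"
    unfolding set_integrable_def by (intro integrable_mult_indicator intSP) simp
qed auto

lemma integral_cball_tendsto:
  "(\<lambda>k. LINT \<omega>|M. (\<Prod>x\<in>\<Phi> \<omega> \<inter> cball 0 (real k). P x) * (\<Sum>x\<in>\<Phi> \<omega> \<inter> cball 0 (real k). S x))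
    \<longlonglongrightarrow> lam * (LINT x|lborel. S x * P x) * exp (lam * (LINT x|lborel. P x - 1))"
proof -
  have UN: "(\<Union>k. cball 0 (real k)) = (UNIV :: 'a set)"
    using real_arch_simple by (auto simp: dist_norm)
  have lim: "(\<lambda>k. LINT x:cball 0 (real k)|lborel. f x) \<longlonglongrightarrow> (LINT x|lborel. f x)"
    if "integrable lborel f" for f :: "'a \<Rightarrow> real"
  proof -
    have "(\<lambda>k. LINT x:cball 0 (real k)|lborel. f x) \<longlonglongrightarrow> (LINT x:(\<Union>k. cball 0 (real k))|lborel. f x)"
      using that by (intro set_integral_cont_up) (auto simp: incseq_def UN set_integrable_def)
    then show ?thesis
      by (simp add: UN set_lebesgue_integral_def)
  qed
  have "(LINT \<omega>|M. (\<Prod>x\<in>\<Phi> \<omega> \<inter> cball 0 (real k). P x) * (\<Sum>x\<in>\<Phi> \<omega> \<inter> cball 0 (real k). S x)) =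
      lam * (LINT x:cball 0 (real k)|lborel. S x * P x) *
        exp (lam * (LINT x:cball 0 (real k)|lborel. P x - 1))" for k
    using has_bochner_integral_cball by (simp add: has_bochner_integral_iff)
  then show ?thesis
    by (simp only:) (intro tendsto_intros lim intP intSP)
qed

end

text \<open>
With factors at least \<open>1\<close> and nonnegative summands, the expression for a ball grows with the ball,
so monotone convergence applies. This supplies the dominating function for the general case.
\<close>

lemma integrable_infprod_infsum_monotone:
  fixes Q T :: "'a \<Rightarrow> real"
  assumes [measurable]: "Q \<in> borel_measurable borel" "T \<in> borel_measurable borel"
    and int: "integrable lborel (\<lambda>x. Q x - 1)" "integrable lborel (\<lambda>x. T x * Q x)"
    and Q: "\<And>x. 1 \<le> Q x" and T: "\<And>x. 0 \<le> T x"
  shows "integrable M (\<lambda>\<omega>. infprod Q (\<Phi> \<omega>) * (\<Sum>\<^sub>\<infinity>x\<in>\<Phi> \<omega>. T x))"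
    and "AE \<omega> in M. \<forall>k. (\<Prod>x\<in>\<Phi> \<omega> \<inter> cball 0 (real k). Q x) * (\<Sum>x\<in>\<Phi> \<omega> \<inter> cball 0 (real k). T x)
      \<le> infprod Q (\<Phi> \<omega>) * (\<Sum>\<^sub>\<infinity>x\<in>\<Phi> \<omega>. T x)"
proof -
  let ?F = "\<lambda>k \<omega>. (\<Prod>x\<in>\<Phi> \<omega> \<inter> cball 0 (real k). Q x) * (\<Sum>x\<in>\<Phi> \<omega> \<inter> cball 0 (real k). T x)"
  let ?D = "\<lambda>\<omega>. infprod Q (\<Phi> \<omega>) * (\<Sum>\<^sub>\<infinity>x\<in>\<Phi> \<omega>. T x)"
  have Q0: "0 \<le> Q x" for x
    using Q[of x] by linarith
  have mono: "mono (\<lambda>k. ?F k \<omega>)" if "\<omega> \<in> space M" for \<omega>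
  proof (rule monoI)
    fix k l :: nat assume "k \<le> l"
    then have sub: "\<Phi> \<omega> \<inter> cball 0 (real k) \<subseteq> \<Phi> \<omega> \<inter> cball 0 (real l)"
      by auto
    have fin: "finite (\<Phi> \<omega> \<inter> cball 0 (real l))"
      using locally_finite[OF that] by simp
    show "?F k \<omega> \<le> ?F l \<omega>"
      using Q Q0 T by (intro mult_mono prod_mono2[OF fin sub] sum_mono2[OF fin sub])
        (auto intro: prod_nonneg sum_nonneg)
  qed
  have lim: "AE \<omega> in M. (\<lambda>k. ?F k \<omega>) \<longlonglongrightarrow> ?D \<omega>"
    by (rule AE_prod_sum_cball_tendsto) (use int in auto)
  show "integrable M ?D"
  proof (rule integrable_monotone_convergence)
    show "integrable M (?F k)" for k
      using has_bochner_integral_cball[OF _ _ int] by (simp add: has_bochner_integral_iff)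
    show "AE \<omega> in M. mono (\<lambda>k. ?F k \<omega>)"
      using mono by (rule AE_I2)
    show "(\<lambda>k. LINT \<omega>|M. ?F k \<omega>) \<longlonglongrightarrow> lam * (LINT x|lborel. T x * Q x) * exp (lam * (LINT x|lborel. Q x - 1))"
      by (rule integral_cball_tendsto) (use int in auto)
    show "?D \<in> borel_measurable M"
      by (rule infprod_infsum_measurable) auto
  qed (rule lim)
  show "AE \<omega> in M. \<forall>k. ?F k \<omega> \<le> ?D \<omega>"
    using lim AE_space
  proof eventually_elim
    case (elim \<omega>)
    show ?case
      using incseq_le[OF _ elim(1)] mono[OF elim(2)] by blast
  qed
qed

text \<open>
Dominated convergence along growing balls. A majorant by \<open>Q = max 1 \<bar>P\<bar>\<close> and
\<open>\<bar>S\<bar>\<close> could have infinite expectation, since \<open>S * Q\<close> need not be integrable. The summand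
\<open>T = \<bar>S * P\<bar> / Q\<close> avoids this: \<open>T * Q = \<bar>S * P\<bar>\<close> is integrable, and the pair
\<open>(Q, T)\<close> still dominates \<open>(P, S)\<close> on every ball by \<open>abs_prod_sum_le\<close>.
\<close>

lemma has_bochner_integral_infprod_infsum:
  fixes P S :: "'a \<Rightarrow> real"
  assumes P[measurable]: "P \<in> borel_measurable borel" and S[measurable]: "S \<in> borel_measurable borel"
    and intP: "integrable lborel (\<lambda>x. P x - 1)" and intSP: "integrable lborel (\<lambda>x. S x * P x)"
  shows "has_bochner_integral M (\<lambda>\<omega>. infprod P (\<Phi> \<omega>) * (\<Sum>\<^sub>\<infinity>x\<in>\<Phi> \<omega>. S x))
    (lam * (LINT x|lborel. S x * P x) * exp (lam * (LINT x|lborel. P x - 1)))"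
proof -
  define Q where "Q x = max 1 \<bar>P x\<bar>" for x
  define T where "T x = \<bar>S x * P x\<bar> / Q x" for x
  let ?F = "\<lambda>k \<omega>. (\<Prod>x\<in>\<Phi> \<omega> \<inter> cball 0 (real k). P x) * (\<Sum>x\<in>\<Phi> \<omega> \<inter> cball 0 (real k). S x)"
  let ?D = "\<lambda>\<omega>. infprod Q (\<Phi> \<omega>) * (\<Sum>\<^sub>\<infinity>x\<in>\<Phi> \<omega>. T x)"
  have Q: "1 \<le> Q x" "\<bar>P x\<bar> \<le> Q x" "0 < Q x" and QP: "\<bar>Q x - 1\<bar> \<le> \<bar>P x - 1\<bar>" for x
    by (auto simp: Q_def)
  have meas[measurable]: "Q \<in> borel_measurable borel" "T \<in> borel_measurable borel"
    unfolding Q_def[abs_def] T_def[abs_def] by measurable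
  have intQ: "integrable lborel (\<lambda>x. Q x - 1)"
    using QP by (intro Bochner_Integration.integrable_bound[OF intP]) auto
  have "T x * Q x = \<bar>S x * P x\<bar>" for x
    using Q(3)[of x] by (simp add: T_def)
  then have intT: "integrable lborel (\<lambda>x. T x * Q x)"
    using intSP by simp
  have T: "0 \<le> T x" for x
    using Q(3)[of x] by (simp add: T_def)
  note D = integrable_infprod_infsum_monotone[OF meas intQ intT Q(1) T]
  have bound: "AE \<omega> in M. norm (?F k \<omega>) \<le> ?D \<omega>" for k
    using D(2) AE_space
  proof eventually_elim
    case (elim \<omega>)
    have "norm (?F k \<omega>) \<le>
        (\<Prod>x\<in>\<Phi> \<omega> \<inter> cball 0 (real k). Q x) * (\<Sum>x\<in>\<Phi> \<omega> \<inter> cball 0 (real k). T x)"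
      using locally_finite[OF elim(2)] Q unfolding T_def real_norm_def
      by (intro abs_prod_sum_le) auto
    also have "\<dots> \<le> ?D \<omega>"
      using elim(1) by blast
    finally show ?case .
  qed
  have meas_lim: "(\<lambda>\<omega>. infprod P (\<Phi> \<omega>) * (\<Sum>\<^sub>\<infinity>x\<in>\<Phi> \<omega>. S x)) \<in> borel_measurable M"
    by (rule infprod_infsum_measurable[OF P S])
  have meas_F: "?F k \<in> borel_measurable M" for k
    by (rule prod_sum_bounded_measurable[OF P S]) auto
  note lim = AE_prod_sum_cball_tendsto[OF P S intP intSP]
  have "integrable M (\<lambda>\<omega>. infprod P (\<Phi> \<omega>) * (\<Sum>\<^sub>\<infinity>x\<in>\<Phi> \<omega>. S x))"
    by (rule integrable_dominated_convergence[OF meas_lim meas_F D(1) lim bound])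
  moreover have "(\<lambda>k. LINT \<omega>|M. ?F k \<omega>) \<longlonglongrightarrow> (LINT \<omega>|M. infprod P (\<Phi> \<omega>) * (\<Sum>\<^sub>\<infinity>x\<in>\<Phi> \<omega>. S x))"
    by (rule integral_dominated_convergence[OF meas_lim meas_F D(1) lim bound])
  then have "(LINT \<omega>|M. infprod P (\<Phi> \<omega>) * (\<Sum>\<^sub>\<infinity>x\<in>\<Phi> \<omega>. S x)) =
      lam * (LINT x|lborel. S x * P x) * exp (lam * (LINT x|lborel. P x - 1))"
    by (rule LIMSEQ_unique[OF _ integral_cball_tendsto[OF P S intP intSP]])
  ultimately show ?thesis
    by (simp add: has_bochner_integral_iff)
qed

end

theorem lemma1:
  fixes M :: "'w measure"
    and lam :: real
    and \<Phi> :: "'w \<Rightarrow> (real ^ 2) set"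
    and S P :: "real ^ 2 \<Rightarrow> real"
  assumes "homogeneous_poisson_process M lam \<Phi>"
    and "S \<in> borel_measurable borel"
    and "P \<in> borel_measurable borel"
    and "integrable lborel (\<lambda>s. S s * P s)"
    and "integrable lborel (\<lambda>s. P s - 1)"
  shows "(AE \<omega> in M. S summable_on \<Phi> \<omega>) \<and>
    (AE \<omega> in M. has_infprod P (infprod P (\<Phi> \<omega>)) (\<Phi> \<omega>)) \<and>
    integrable M (\<lambda>\<omega>. infprod P (\<Phi> \<omega>) * (\<Sum>\<^sub>\<infinity>x\<in>\<Phi> \<omega>. S x)) \<and>
    (LINT \<omega>|M. infprod P (\<Phi> \<omega>) * (\<Sum>\<^sub>\<infinity>x\<in>\<Phi> \<omega>. S x)) =
      lam * (LINT s|lborel. S s * P s) * exp (lam * (LINT s|lborel. P s - 1))"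
proof -
  interpret homogeneous_poisson_process M lam \<Phi> by fact
  note asms = assms(3,2,5,4)
  have "AE \<omega> in M. has_infprod P (infprod P (\<Phi> \<omega>)) (\<Phi> \<omega>)"
    using AE_summable_deviation[OF asms] by eventually_elim (rule has_infprod_infprod)
  then show ?thesis
    using AE_summable_summand[OF asms] has_bochner_integral_infprod_infsum[OF asms]
    by (simp add: has_bochner_integral_iff)
qed

end
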